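(* For $n\ge 1$ let $W(n)$ be the set of weight sequences of planar rooted binary trees with $n$ leaves, with its Tamari lattice structure. For $u\in W(m)$, $v\in W(n)$ and $1\le i\le m$ let $$u\circ_i v:=(u_1,\dots,u_{i-1},v_1,\dots,v_{n-1},v_n+u_i-1,u'_{i+1},\dots,u'_m),$$ where $u'_j=u_j+n-1$ if $u_j\ge j-i+1$ and $u'_j=u_j$ otherwise. These partial compositions respect the lattice structures on the $W(n)$, i.e. each map $\circ_i: W(m)\times W(n)\to W(m+n-1)$ is a lattice homomorphism. That is, the non-symmetric operad $PBT\simeq W$ of planar rooted binary trees (with grafting) is a lattice operad with respect to the Tamari order.
   Context: $PBT$ is the free non-symmetric operad in sets on one binary generator: $PBT(n)$ is the set of planar rooted binary trees with $n$ leaves (for $n=1$, only the trivial tree), and $S\circ_i T$ is obtained by grafting the root of $T$ onto the $i$-th leaf of $S$ (leaves numbered from left to right). The weight sequence of $T\in PBT(n)$ is $w_T=(w_T(1),\dots,w_T(n))$, where $w_T(i)$ is the number of leaves of the largest subtree of $T$ (a vertex or leaf together with all its descendants) whose rightmost leaf is leaf $i$; a subtree may consist of the single leaf $i$, with $w_T(i)=1$. One has $w_T(n)=n$. The assignment $T\mapsto w_T$ is a bijection $PBT(n)\to W(n)$, and it carries grafting to the operation $u\circ_i v=(u_1,\dots,u_{i-1},v_1,\dots,v_{n-1},v_n+u_i-1,u'_{i+1},\dots,u'_m)$ for $u\in W(m)$, $v\in W(n)$, $1\le i\le m$, where $u'_j=u_j+n-1$ if $u_j\ge j-i+1$ and $u'_j=u_j$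 otherwise; that is, $w_{S\circ_i T}=w_S\circ_i w_T$ for $S\in PBT(m)$, $T\in PBT(n)$. The Tamari order on $PBT(n)$ is the transitive (and reflexive) closure of left rotations, which replace a subtree of the form $A(BC)$ (left subtree $A$; right subtree having left subtree $B$ and right subtree $C$) by $(AB)C$. Under $T\mapsto w_T$ it corresponds to the coordinate-wise order on $W(n)\subset\mathbb N^n$. In $W(n)$ the meet is the coordinate-wise minimum, and the join is $u\vee v=h(\max(u_1,v_1),\dots,\max(u_n,v_n))$, where for a positive integer vector $u$, $h(u)=(z_1,\dots,z_n)$ is defined inductively for $i=1,\dots,n$ by letting $z_i$ be the maximum of $u_i$ and all $z_j+i-j$ with $j\ge 1$, $i-u_i<j<i$. A (non-symmetric) lattice operad is a non-symmetric operad in the category of lattices and lattice homomorphisms with the cartesian product: each component is a lattice and each partial composition $\circ_i$ is a lattice homomorphism from the product lattice, i.e. $(p\wedge r)\circ_i(q\wedge s)=(p\circ_i q)\wedge(r\circ_i s)$ and $(p\vee r)\circ_i(q\vee s)=(p\circ_i q)\vee(r\circ_i s)$. *)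

theory Defs
  imports "HOL-Algebra.Lattice"
begin

section \<open>Planar rooted binary trees, grafting and the Tamari order\<close>

datatype pbt = Leaf | Node pbt pbt

fun leaves :: "pbt \<Rightarrow> nat" where
  "leaves Leaf = 1"
| "leaves (Node l r) = leaves l + leaves r"

definition PBT :: "nat \<Rightarrow> pbt set" where
  "PBT n = {T. leaves T = n}"

text \<open>
  \<open>graft S i T\<close> is the partial composition of \<open>S\<close> with \<open>T\<close> at \<open>i\<close>: the root of \<open>T\<close> is grafted onto the
  \<open>i\<close>-th leaf of \<open>S\<close>. Leaves are numbered from left to right starting with 1, and only
  \<open>1 \<le> i \<le> leaves S\<close> is meaningful.
\<close>
fun graft :: "pbt \<Rightarrow> nat \<Rightarrow> pbt \<Rightarrow> pbt" where
  "graft Leaf i T = T"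
| "graft (Node l r) i T =
     (if i \<le> leaves l then Node (graft l i T) r else Node l (graft r (i - leaves l) T))"

inductive left_rotation :: "pbt \<Rightarrow> pbt \<Rightarrow> bool" where
  root: "left_rotation (Node A (Node B C)) (Node (Node A B) C)"
| left: "left_rotation l l' \<Longrightarrow> left_rotation (Node l r) (Node l' r)"
| right: "left_rotation r r' \<Longrightarrow> left_rotation (Node l r) (Node l r')"

definition Tamari :: "nat \<Rightarrow> pbt gorder" where
  "Tamari n = \<lparr>carrier = PBT n, eq = (=), le = left_rotation\<^sup>*\<^sup>*\<rparr>"

section \<open>Weight sequences\<close>

text \<open>
  The occurrences of subtrees in a tree, each recorded together with the number of leaves of the
  tree lying to its left. The rightmost leaf of an occurrence \<open>(k, S)\<close> thus has number
  \<open>k + leaves S\<close>.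
\<close>
fun subtrees :: "pbt \<Rightarrow> (nat \<times> pbt) set" where
  "subtrees Leaf = {(0, Leaf)}"
| "subtrees (Node l r) =
     {(0, Node l r)} \<union> subtrees l \<union> (\<lambda>(k, S). (leaves l + k, S)) ` subtrees r"

definition weight :: "pbt \<Rightarrow> nat \<Rightarrow> nat" where
  "weight T i = Max {leaves S |k S. (k, S) \<in> subtrees T \<and> k + leaves S = i}"

definition weight_seq :: "pbt \<Rightarrow> nat list" where
  "weight_seq T = map (weight T) [1..<leaves T + 1]"

definition W :: "nat \<Rightarrow> nat list set" where
  "W n = weight_seq ` PBT n"

text \<open>Weight sequences with the coordinate-wise order.\<close>
definition W_lattice :: "nat \<Rightarrow> nat list gorder" where
  "W_lattice n = \<lparr>carrier = W n, eq = (=), le = list_all2 (\<le>)\<rparr>"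

text \<open>
  Sequences are numbered from 1 in the mathematics and from 0 as lists, so that the \<open>j\<close>-th entry
  of \<open>u\<close> is \<open>u ! (j - 1)\<close>. No subtraction is truncated when \<open>1 \<le> i \<le> length u\<close> and the entries are
  positive.
\<close>
definition W_comp :: "nat list \<Rightarrow> nat \<Rightarrow> nat list \<Rightarrow> nat list" where
  "W_comp u i v =
     (let m = length u;
          n = length v;
          u' = (\<lambda>j. if u ! (j - 1) \<ge> j - i + 1 then u ! (j - 1) + n - 1 else u ! (j - 1))
      in take (i - 1) u @ butlast v @ [last v + u ! (i - 1) - 1] @ map u' [i + 1..<m + 1])"

section \<open>Lattice homomorphisms\<close>

definition prod_gorder :: "'a gorder \<Rightarrow> 'b gorder \<Rightarrow> ('a \<times> 'b) gorder" where
  "prod_gorder L M =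
     \<lparr>carrier = carrier L \<times> carrier M,
      eq = (\<lambda>(a, b) (c, d). a .=\<^bsub>L\<^esub> c \<and> b .=\<^bsub>M\<^esub> d),
      le = (\<lambda>(a, b) (c, d). a \<sqsubseteq>\<^bsub>L\<^esub> c \<and> b \<sqsubseteq>\<^bsub>M\<^esub> d)\<rparr>"

definition lattice_hom :: "'a gorder \<Rightarrow> 'b gorder \<Rightarrow> ('a \<Rightarrow> 'b) set" where
  "lattice_hom L M =
     {f \<in> carrier L \<rightarrow> carrier M.
        \<forall>x\<in>carrier L. \<forall>y\<in>carrier L.
          f (x \<sqinter>\<^bsub>L\<^esub> y) = f x \<sqinter>\<^bsub>M\<^esub> f y \<and> f (x \<squnion>\<^bsub>L\<^esub> y) = f x \<squnion>\<^bsub>M\<^esub> f y}"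

section \<open>Non-symmetric operads\<close>

text \<open>
  Non-symmetric operads in sets without nullary operations, presented by partial compositions:
  \<open>P n\<close> is the component of arity \<open>n \<ge> 1\<close> (\<open>P 0\<close> plays no role) and \<open>comp x i y\<close> is the partial
  composition of \<open>x\<close> and \<open>y\<close> at \<open>i\<close>. The arities are not passed to \<open>comp\<close>.
\<close>
locale ns_operad =
  fixes P :: "nat \<Rightarrow> 'a set"
    and comp :: "'a \<Rightarrow> nat \<Rightarrow> 'a \<Rightarrow> 'a"
    and unit :: 'a
  assumes unit_closed: "unit \<in> P 1"
    and comp_closed:
      "\<lbrakk>x \<in> P m; y \<in> P n; 1 \<le> i; i \<le> m; 1 \<le> n\<rbrakk> \<Longrightarrow> comp x i y \<in> P (m + n - 1)"
    and left_unit: "\<lbrakk>y \<in> P n; 1 \<le> n\<rbrakk> \<Longrightarrow> comp unit 1 y = y"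
    and right_unit: "\<lbrakk>x \<in> P m; 1 \<le> i; i \<le> m\<rbrakk> \<Longrightarrow> comp x i unit = x"
    and sequential_assoc:
      "\<lbrakk>x \<in> P l; y \<in> P m; z \<in> P n; 1 \<le> i; i \<le> l; 1 \<le> j; j \<le> m; 1 \<le> n\<rbrakk>
        \<Longrightarrow> comp (comp x i y) (i + j - 1) z = comp x i (comp y j z)"
    and parallel_assoc:
      "\<lbrakk>x \<in> P l; y \<in> P m; z \<in> P n; 1 \<le> i; i < k; k \<le> l; 1 \<le> m; 1 \<le> n\<rbrakk>
        \<Longrightarrow> comp (comp x i y) (k + m - 1) z = comp (comp x k z) i y"

locale lattice_operad = ns_operad "\<lambda>n. carrier (L n)" comp unit
  for L :: "nat \<Rightarrow> 'a gorder" and comp :: "'a \<Rightarrow> nat \<Rightarrow> 'a \<Rightarrow> 'a" and unit :: 'a +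
  assumes component_lattice: "1 \<le> n \<Longrightarrow> lattice (L n)"
    and comp_hom:
      "\<lbrakk>1 \<le> i; i \<le> m; 1 \<le> n\<rbrakk>
        \<Longrightarrow> (\<lambda>(x, y). comp x i y) \<in> lattice_hom (prod_gorder (L m) (L n)) (L (m + n - 1))"

definition lattice_operad_iso ::
  "(nat \<Rightarrow> 'a gorder) \<Rightarrow> ('a \<Rightarrow> nat \<Rightarrow> 'a \<Rightarrow> 'a) \<Rightarrow> 'a \<Rightarrow>
   (nat \<Rightarrow> 'b gorder) \<Rightarrow> ('b \<Rightarrow> nat \<Rightarrow> 'b \<Rightarrow> 'b) \<Rightarrow> 'b \<Rightarrow> ('a \<Rightarrow> 'b) \<Rightarrow> bool" where
  "lattice_operad_iso L compL unitL M compM unitM f \<longleftrightarrow>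
     (\<forall>n\<ge>1. bij_betw f (carrier (L n)) (carrier (M n)) \<and> order_emb (L n) (M n) f) \<and>
     f unitL = unitM \<and>
     (\<forall>m n i. 1 \<le> i \<longrightarrow> i \<le> m \<longrightarrow> 1 \<le> n \<longrightarrow>
        (\<forall>x\<in>carrier (L m). \<forall>y\<in>carrier (L n). f (compL x i y) = compM (f x) i (f y)))"

end

theory Submission
  imports Defs
begin

text \<open>
  List, in inorder, the number of leaves of the left subtree of every internal node: the largest
  subtree whose rightmost leaf is the \<open>i\<close>-th one, \<open>i < n\<close>, is the left subtree of the node
  separating the leaves \<open>i\<close> and \<open>i + 1\<close>, so this list is the weight sequence without its last
  entry \<open>n\<close>. Inorder lists are easy to cut at a node, which shows that left rotations generate the
  coordinate-wise order. Weight sequences are the sequences whose intervals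
  \<open>(i - w i, i]\<close> form a laminar family; they are closed under coordinate-wise minima, and
  the formula for grafting is monotone in each entry, so grafting preserves meets. Reflecting trees
  reverses the Tamari order and is compatible with grafting, hence joins exist and are preserved as
  well, without any recourse to a formula for them.
\<close>

section \<open>Weight sequences as inorder lists\<close>

lemma leaves_pos [simp]: "0 < leaves T"
  by (induction T) auto

fun left_sizes :: "pbt \<Rightarrow> nat list" where
  "left_sizes Leaf = []"
| "left_sizes (Node l r) = left_sizes l @ leaves l # left_sizes r"

lemma Suc_length_left_sizes [simp]: "Suc (length (left_sizes T)) = leaves T"
  by (induction T) auto

lemma length_left_sizes: "length (left_sizes T) = leaves T - 1"
  using Suc_length_left_sizes[of T] by linarith

lemma subtrees_bound:
  "(k, S) \<in> subtrees T \<Longrightarrow> k + leaves S \<le> leaves T"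
proof (induction T arbitrary: k)
  case (Node l r)
  then show ?case by fastforce
qed auto

lemma root_in_subtrees: "(0, T) \<in> subtrees T"
  by (cases T) auto

text \<open>The whole tree ends at its last leaf and no subtree is larger, so the maximum is
  attained at the root.\<close>

lemma weight_leaves: "weight T (leaves T) = leaves T"
  unfolding weight_def
proof (rule Max_eqI)
  show "finite {leaves S |k S. (k, S) \<in> subtrees T \<and> k + leaves S = leaves T}"
    by (rule finite_subset[of _ "{..leaves T}"]) (auto dest: subtrees_bound)
  show "leaves T \<in> {leaves S |k S. (k, S) \<in> subtrees T \<and> k + leaves S = leaves T}"
    using root_in_subtrees by force
qed (auto dest: subtrees_bound)

text \<open>The whole tree and all subtrees of \<open>r\<close> end strictly to the right of leaf
  \<open>leaves l\<close>, so only subtrees of \<open>l\<close> compete.\<close>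

lemma weight_Node_left:
  assumes "i \<le> leaves l"
  shows "weight (Node l r) i = weight l i"
proof -
  have ne: "leaves l + k + leaves S \<noteq> i" "leaves l + leaves r \<noteq> i" for k S
    using assms leaves_pos[of S] leaves_pos[of r] by linarith+
  have "(k, S) \<in> subtrees (Node l r) \<and> k + leaves S = i \<longleftrightarrow>
      (k, S) \<in> subtrees l \<and> k + leaves S = i" for k S
    using ne by auto
  then show ?thesis by (simp only: weight_def)
qed

text \<open>Subtrees of \<open>l\<close> end too early. The strict bound on \<open>i\<close> leaves
  out the last leaf, where the whole tree is a new and larger competitor.\<close>

lemma weight_Node_right:
  assumes "0 < i" "i < leaves r"
  shows "weight (Node l r) (leaves l + i) = weight r i"
proof -
  have ne: "k + leaves S \<noteq> leaves l + i" if "(k, S) \<in> subtrees l" for k S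
    using assms subtrees_bound[OF that] by linarith
  have "(k, S) \<in> subtrees (Node l r) \<and> k + leaves S = leaves l + i \<longleftrightarrow>
      (\<exists>j. k = leaves l + j \<and> (j, S) \<in> subtrees r \<and> j + leaves S = i)" for k S
    using ne[of k S] assms by auto
  then have "(\<exists>k S. x = leaves S \<and> (k, S) \<in> subtrees (Node l r) \<and> k + leaves S = leaves l + i) \<longleftrightarrow>
      (\<exists>k S. x = leaves S \<and> (k, S) \<in> subtrees r \<and> k + leaves S = i)" for x
    by metis
  then show ?thesis by (simp only: weight_def)
qed

text \<open>The entry of the root of \<open>Node l r\<close> is the weight of the last leaf of
  \<open>l\<close>, exactly the one that \<open>left_sizes l\<close> omits.\<close>

lemma left_sizes_eq_weight: "left_sizes T = map (weight T) [1..<leaves T]"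
proof (induction T)
  case (Node l r)
  have "[1..<leaves (Node l r)] = [1..<leaves l] @ leaves l # map ((+) (leaves l)) [1..<leaves r]"
    using leaves_pos[of l] leaves_pos[of r]
    by (intro nth_equalityI) (auto simp: nth_append nth_Cons' simp del: leaves_pos)
  then show ?case
    using Node
    by (auto simp: weight_Node_left weight_Node_right weight_leaves)
qed simp

lemma weight_seq_eq: "weight_seq T = left_sizes T @ [leaves T]"
  using leaves_pos[of T]
  by (simp add: weight_seq_def left_sizes_eq_weight weight_leaves Suc_le_eq del: leaves_pos)

lemma length_weight_seq [simp]: "length (weight_seq T) = leaves T"
  by (simp add: weight_seq_def)

text \<open>The left subtree counted by entry \<open>k\<close> ends at leaf \<open>k + 1\<close> of
  the tree, so it has at most that many leaves.\<close>

lemma left_sizes_le: "k < length (left_sizes T) \<Longrightarrow> left_sizes T ! k \<le> Suc k"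
proof (induction T arbitrary: k)
  case (Node l r)
  show ?case
  proof (cases "k < leaves l")
    case True
    then show ?thesis
      using Node.IH(1)[of k] by (cases "k = leaves l - 1") (auto simp: nth_append length_left_sizes)
  next
    case False
    then have "k - leaves l < length (left_sizes r)"
      using Node.prems leaves_pos[of l] by (simp add: length_left_sizes del: leaves_pos)
    from Node.IH(2)[OF this] False show ?thesis
      using leaves_pos[of l]
      by (auto simp: nth_append length_left_sizes nth_Cons' simp del: leaves_pos)
  qed
qed simp

section \<open>The Tamari order in terms of weights\<close>

lemma left_rotation_leaves: "left_rotation S T \<Longrightarrow> leaves S = leaves T"
  by (induction rule: left_rotation.induct) auto

text \<open>Rotating \<open>A(BC)\<close> to \<open>(AB)C\<close> keeps the inorder list except for
  one entry, which grows from \<open>leaves B\<close> to \<open>leaves A + leaves B\<close>. The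
  strictness serves to show that trees are determined by their lists.\<close>

lemma left_rotation_left_sizes:
  "left_rotation S T \<Longrightarrow>
     list_all2 (\<le>) (left_sizes S) (left_sizes T) \<and> left_sizes S \<noteq> left_sizes T"
proof (induction rule: left_rotation.induct)
  case (left l l' r)
  then show ?case
    by (auto simp: left_rotation_leaves length_left_sizes intro!: list_all2_appendI list_all2_refl)
qed (auto intro!: list_all2_appendI list_all2_refl)

lemma left_rotations_left_sizes:
  "left_rotation\<^sup>*\<^sup>* S T \<Longrightarrow> list_all2 (\<le>) (left_sizes S) (left_sizes T)"
  by (induction rule: rtranclp_induct)
    (auto intro: list_all2_refl list_all2_trans[OF order_trans] dest: left_rotation_left_sizes)

lemma left_rotations_Node:
  assumes "left_rotation\<^sup>*\<^sup>* l l'" "left_rotation\<^sup>*\<^sup>* r r'"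
  shows "left_rotation\<^sup>*\<^sup>* (Node l r) (Node l' r')"
proof -
  have "left_rotation\<^sup>*\<^sup>* (Node l r) (Node l' r)"
    using assms(1)
    by (induction rule: rtranclp_induct) (auto intro: rtranclp.rtrancl_into_rtrancl left_rotation.left)
  also have "left_rotation\<^sup>*\<^sup>* (Node l' r) (Node l' r')"
    using assms(2)
    by (induction rule: rtranclp_induct) (auto intro: rtranclp.rtrancl_into_rtrancl left_rotation.right)
  finally show ?thesis .
qed

text \<open>
  The bound on \<open>zs\<close> forces the chosen node onto the right spine, from where left rotations
  bring it to the root.
\<close>
lemma left_rotations_to_root:
  assumes "left_sizes S = xs @ y # zs" "\<And>k. k < length zs \<Longrightarrow> zs ! k \<le> Suc k"
  shows "\<exists>X Y. left_rotation\<^sup>*\<^sup>* S (Node X Y) \<and> left_sizes X = xs \<and> left_sizes Y = zs"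
  using assms
proof (induction S arbitrary: xs)
  case (Node l r)
  from Node.prems(1)
  consider (eq) "left_sizes l = xs" "left_sizes r = zs"
    | (gt) ws where "left_sizes l = xs @ y # ws" "zs = ws @ leaves l # left_sizes r"
    | (lt) ws where "xs = left_sizes l @ leaves l # ws" "left_sizes r = ws @ y # zs"
    by (auto simp: append_eq_append_conv2 append_eq_Cons_conv Cons_eq_append_conv)
  then show ?case
  proof cases
    case eq
    then show ?thesis by blast
  next
    \<comment> \<open>The chosen node lies in \<open>l\<close>, so the root of \<open>S\<close>
      occurs in \<open>zs\<close> at position \<open>length ws\<close>, where its entry
      \<open>leaves l\<close> exceeds the bound.\<close>
    case gt
    then have "leaves l \<le> Suc (length ws)"
      using Node.prems(2)[of "length ws"] by simp
    moreover have "leaves l = length xs + length ws + 2"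
      using gt(1) Suc_length_left_sizes[of l] by simp
    ultimately show ?thesis by simp
  next
    case lt
    then obtain X Y where XY: "left_rotation\<^sup>*\<^sup>* r (Node X Y)" "left_sizes X = ws" "left_sizes Y = zs"
      using Node.IH(2)[OF lt(2) Node.prems(2)] by blast
    have "left_rotation\<^sup>*\<^sup>* (Node l r) (Node l (Node X Y))"
      using XY(1) by (intro left_rotations_Node) auto
    also have "left_rotation (Node l (Node X Y)) (Node (Node l X) Y)"
      by (rule left_rotation.root)
    finally show ?thesis
      using XY lt by (intro exI[of _ "Node l X"] exI[of _ Y]) auto
  qed
qed simp

text \<open>For the converse, the list of \<open>S\<close> is cut at the position of the root of
  \<open>T\<close>. The part after the cut is dominated by \<open>left_sizes r\<close> and inherits
  its bounds, so left rotations bring the node at the cut to the root. The two subtrees are then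
  compared by induction.\<close>

lemma left_rotations_iff_left_sizes:
  "left_rotation\<^sup>*\<^sup>* S T \<longleftrightarrow> list_all2 (\<le>) (left_sizes S) (left_sizes T)"
proof
  assume "list_all2 (\<le>) (left_sizes S) (left_sizes T)"
  then show "left_rotation\<^sup>*\<^sup>* S T"
  proof (induction T arbitrary: S)
    case Leaf
    then show ?case by (cases S) auto
  next
    case (Node l r)
    then obtain xs y zs where S: "left_sizes S = xs @ y # zs"
      and le: "list_all2 (\<le>) xs (left_sizes l)" "list_all2 (\<le>) zs (left_sizes r)"
      by (auto simp: list_all2_append2 list_all2_Cons2)
    have "zs ! k \<le> Suc k" if "k < length zs" for k
      using le(2) that left_sizes_le[of k r]
      by (metis list_all2_conv_all_nth order_trans)
    from left_rotations_to_root[OF S this]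
    obtain X Y where XY: "left_rotation\<^sup>*\<^sup>* S (Node X Y)"
      and "left_sizes X = xs" "left_sizes Y = zs"
      by blast
    then have "left_rotation\<^sup>*\<^sup>* (Node X Y) (Node l r)"
      using Node.IH le by (intro left_rotations_Node) auto
    with XY show ?case by (rule rtranclp_trans)
  qed
qed (rule left_rotations_left_sizes)

text \<open>Equal lists give a chain of left rotations from \<open>S\<close> to \<open>T\<close>. A
  first step in that chain would change the list by raising an entry, and later steps cannot lower
  it again.\<close>

lemma left_sizes_inject: "left_sizes S = left_sizes T \<longleftrightarrow> S = T"
proof
  assume eq: "left_sizes S = left_sizes T"
  then have "left_rotation\<^sup>*\<^sup>* S T"
    by (simp add: left_rotations_iff_left_sizes list_all2_refl)
  then show "S = T"
  proof (cases rule: converse_rtranclpE)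
    case (step S')
    then have "left_sizes S \<noteq> left_sizes S'" "list_all2 (\<le>) (left_sizes S) (left_sizes S')"
      "list_all2 (\<le>) (left_sizes S') (left_sizes S)"
      using left_rotation_left_sizes[of S S'] by (auto simp: left_rotations_iff_left_sizes eq)
    then show ?thesis
      using list_all2_antisym[of "(\<le>)" "(\<le>)" "left_sizes S" "left_sizes S'"] by auto
  qed
qed simp

lemma left_rotations_iff_weight_seq:
  assumes "leaves S = leaves T"
  shows "left_rotation\<^sup>*\<^sup>* S T \<longleftrightarrow> list_all2 (\<le>) (weight_seq S) (weight_seq T)"
  using assms
  by (auto simp: left_rotations_iff_left_sizes weight_seq_eq length_left_sizes list_all2_append)

lemma weight_seq_nonempty [simp]: "weight_seq T \<noteq> []"
  by (simp add: weight_seq_eq)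

lemma weight_seq_inject: "weight_seq S = weight_seq T \<longleftrightarrow> S = T"
  by (auto simp: weight_seq_eq left_sizes_inject)

section \<open>Meets of weight sequences\<close>

text \<open>
  Entry \<open>k\<close> belongs to leaf \<open>k + 1\<close>. The last condition says that the interval of leaves ending at
  \<open>j + 1\<close> is contained in the one ending at \<open>k + 1\<close> as soon as they meet.
\<close>
definition laminar :: "nat list \<Rightarrow> bool" where
  "laminar x \<longleftrightarrow> (\<forall>k<length x. 1 \<le> x ! k \<and> x ! k \<le> Suc k \<and>
     (\<forall>j<k. k < j + x ! k \<longrightarrow> x ! j + (k - j) \<le> x ! k))"

text \<open>The intervals are leaf sets of subtrees, hence nested or disjoint. The proof splits the
  positions into those of \<open>l\<close>, the root and those of \<open>r\<close>.\<close>

lemma laminar_left_sizes: "laminar (left_sizes T)"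
proof (induction T)
  case (Node l r)
  have len: "length (left_sizes l) = leaves l - 1" "length (left_sizes r) = leaves r - 1" "leaves l > 0"
    by (auto simp: length_left_sizes)
  let ?x = "left_sizes (Node l r)"
  have l: "?x ! k = left_sizes l ! k" if "Suc k < leaves l" for k
    using that len by (auto simp: nth_append)
  have m: "?x ! k = leaves l" if "Suc k = leaves l" for k
    using that len by (auto simp: nth_append)
  have r: "?x ! k = left_sizes r ! (k - leaves l)" if "leaves l \<le> k" for k
    using that len by (auto simp: nth_append nth_Cons' simp del: leaves_pos)
  show ?case
    unfolding laminar_def
  proof (intro allI impI)
    fix k assume k: "k < length ?x"
    consider "Suc k < leaves l" | "Suc k = leaves l" | "leaves l \<le> k" by linarith
    then show "1 \<le> ?x ! k \<and> ?x ! k \<le> Suc k \<and>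
       (\<forall>j<k. k < j + ?x ! k \<longrightarrow> ?x ! j + (k - j) \<le> ?x ! k)"
    proof cases
      case 1
      then show ?thesis
        using Node.IH(1) len by (auto simp: laminar_def l simp del: left_sizes.simps)
    next
      case 2
      have "?x ! j + (k - j) \<le> ?x ! k" if "j < k" for j
      proof -
        have "j < length (left_sizes l)" using that 2 len(1) by linarith
        from left_sizes_le[OF this] show ?thesis
          using that 2 by (simp add: l m del: left_sizes.simps)
      qed
      then show ?thesis
        using 2 by (simp add: m del: left_sizes.simps)
    next
      case 3
      have kr: "k - leaves l < length (left_sizes r)"
        using 3 k len Suc_length_left_sizes[of r] by simp
      have IH: "1 \<le> left_sizes r ! (k - leaves l)" "left_sizes r ! (k - leaves l) \<le> Suc (k - leaves l)"
         "\<And>j. j < k - leaves l \<Longrightarrow> k - leaves l < j + left_sizes r ! (k - leaves l) \<Longrightarrow>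
           left_sizes r ! j + (k - leaves l - j) \<le> left_sizes r ! (k - leaves l)"
        using Node.IH(2) kr by (auto simp: laminar_def)
      have "?x ! j + (k - j) \<le> ?x ! k" if "j < k" "k < j + ?x ! k" for j
      proof -
        \<comment> \<open>An interval ending at a position of \<open>r\<close> cannot reach back
          into \<open>l\<close>, so \<open>j\<close> is a position of \<open>r\<close> too.\<close>
        have "leaves l \<le> j" using that 3 IH(2) by (simp add: r del: left_sizes.simps)
        then show ?thesis using IH(3)[of "j - leaves l"] that 3
          by (simp add: r del: left_sizes.simps)
      qed
      then show ?thesis
        using IH 3 by (auto simp: r simp del: left_sizes.simps)
    qed
  qed
qed (simp add: laminar_def)

text \<open>The root belongs at \<open>p\<close>, the last position whose interval starts at the
  first leaf. The entries before and after \<open>p\<close> are again laminar and describe the two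
  subtrees.\<close>

lemma laminar_imp_left_sizes: "laminar x \<Longrightarrow> \<exists>T. left_sizes T = x"
proof (induction x rule: length_induct)
  case (1 x)
  show ?case
  proof (cases "x = []")
    case True
    then show ?thesis by (intro exI[of _ Leaf]) simp
  next
    case False
    have lam: "1 \<le> x ! k" "x ! k \<le> Suc k" "j < k \<Longrightarrow> k < j + x ! k \<Longrightarrow> x ! j + (k - j) \<le> x ! k"
      if "k < length x" for j k
      using 1(2) that by (auto simp: laminar_def)
    define p where "p = (GREATEST p. p < length x \<and> x ! p = Suc p)"
    have ex: "0 < length x \<and> x ! 0 = Suc 0"
      using False lam(1,2)[of 0] by auto
    have p: "p < length x" "x ! p = Suc p"
      using GreatestI_nat[of "\<lambda>p. p < length x \<and> x ! p = Suc p" 0 "length x", OF ex]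
      unfolding p_def by auto
    have max: "k \<le> p" if "k < length x" "x ! k = Suc k" for k
      unfolding p_def using that by (intro Greatest_le_nat[where b = "length x"]) auto
    have "laminar (take p x)"
      using p lam by (auto simp: laminar_def)
    moreover have "laminar (drop (Suc p) x)"
      unfolding laminar_def
    proof (intro allI impI)
      fix k assume "k < length (drop (Suc p) x)"
      then have k: "Suc p + k < length x" by simp
      have "x ! (Suc p + j) + (k - j) \<le> x ! (Suc p + k)" if "j < k" "k < j + x ! (Suc p + k)" for j
        using lam(3)[OF k, of "Suc p + j"] that by simp
      \<comment> \<open>A larger entry would give an interval meeting the one at \<open>p\<close>,
        hence containing it and starting at the first leaf, against the maximality of
        \<open>p\<close>.\<close>
      moreover have "x ! (Suc p + k) \<le> Suc k"
      proof (rule ccontr)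
        assume "\<not> ?thesis"
        then have "Suc (Suc p + k) \<le> x ! (Suc p + k)"
          using lam(3)[OF k, of p] p(2) by simp
        then show False
          using max[OF k] lam(2)[OF k] by simp
      qed
      ultimately show "1 \<le> drop (Suc p) x ! k \<and> drop (Suc p) x ! k \<le> Suc k \<and>
        (\<forall>j<k. k < j + drop (Suc p) x ! k \<longrightarrow> drop (Suc p) x ! j + (k - j) \<le> drop (Suc p) x ! k)"
        using lam(1)[OF k] k by simp
    qed
    moreover have "length (take p x) < length x" "length (drop (Suc p) x) < length x"
      using p(1) by auto
    ultimately obtain l r where "left_sizes l = take p x" "left_sizes r = drop (Suc p) x"
      using 1(1) by metis
    moreover from this have "leaves l = x ! p"
      using p Suc_length_left_sizes[of l] by simp
    ultimately show ?thesis
      using p(1) by (intro exI[of _ "Node l r"]) (simp add: id_take_nth_drop[symmetric])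
  qed
qed

text \<open>A position within reach of the smaller of the two intervals at \<open>k\<close> is
  within reach of both, so both containment inequalities hold and their minimum can be
  taken.\<close>

lemma laminar_min:
  assumes "laminar x" "laminar y" "length x = length y"
  shows "laminar (map2 min x y)"
  unfolding laminar_def
proof (intro allI impI)
  fix k assume "k < length (map2 min x y)"
  then have k: "k < length x" "k < length y" using assms by auto
  have x: "1 \<le> x ! k" "x ! k \<le> Suc k"
    "\<And>j. j < k \<Longrightarrow> k < j + x ! k \<Longrightarrow> x ! j + (k - j) \<le> x ! k"
    using assms(1) k by (auto simp: laminar_def)
  have y: "1 \<le> y ! k" "y ! k \<le> Suc k"
    "\<And>j. j < k \<Longrightarrow> k < j + y ! k \<Longrightarrow> y ! j + (k - j) \<le> y ! k"
    using assms(2) k by (auto simp: laminar_def)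
  have "min (x ! j) (y ! j) + (k - j) \<le> min (x ! k) (y ! k)"
    if "j < k" "k < j + min (x ! k) (y ! k)" for j
    using x(3)[of j] y(3)[of j] that by linarith
  then show "1 \<le> map2 min x y ! k \<and> map2 min x y ! k \<le> Suc k \<and>
     (\<forall>j<k. k < j + map2 min x y ! k \<longrightarrow> map2 min x y ! j + (k - j) \<le> map2 min x y ! k)"
    using k x y by auto
qed

text \<open>Laminarity provides a tree for all entries but the last; the last entries of
  \<open>S\<close> and \<open>T\<close> agree because the numbers of leaves do.\<close>

lemma weight_seq_min:
  assumes "leaves S = leaves T"
  shows "\<exists>M. weight_seq M = map2 min (weight_seq S) (weight_seq T)"
proof -
  have len: "length (left_sizes S) = length (left_sizes T)"
    using assms by (simp add: length_left_sizes)
  then obtain M where M: "left_sizes M = map2 min (left_sizes S) (left_sizes T)"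
    using laminar_imp_left_sizes laminar_min laminar_left_sizes by metis
  moreover have "leaves M = leaves S"
    using arg_cong[OF M, of length] len Suc_length_left_sizes[of M] Suc_length_left_sizes[of S] by simp
  ultimately show ?thesis
    using len assms by (intro exI[of _ M]) (simp add: weight_seq_eq)
qed

section \<open>Grafting of weight sequences\<close>

lemma weight_seq_le: "k < leaves T \<Longrightarrow> weight_seq T ! k \<le> Suc k"
  using left_sizes_le[of k T] by (auto simp: weight_seq_eq nth_append length_left_sizes)

lemma last_weight_seq [simp]: "last (weight_seq T) = leaves T"
  by (simp add: weight_seq_eq)

text \<open>The last leaf needs its own case, since the weight \<open>leaves r\<close> that it has
  in \<open>r\<close> is replaced by that of the whole tree.\<close>

lemma nth_weight_seq_Node:
  assumes "k < leaves l + leaves r"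
  shows "weight_seq (Node l r) ! k =
    (if k < leaves l then weight_seq l ! k
     else if Suc k = leaves l + leaves r then leaves l + leaves r
     else weight_seq r ! (k - leaves l))"
proof -
  have "weight_seq (Node l r) = weight_seq l @ butlast (weight_seq r) @ [leaves l + leaves r]"
    by (simp add: weight_seq_eq)
  then show ?thesis
    using assms by (auto simp: nth_append nth_butlast)
qed

lemma leaves_graft:
  assumes "1 \<le> i" "i \<le> leaves S"
  shows "leaves (graft S i T) = leaves S + leaves T - 1"
  using assms
proof (induction S arbitrary: i)
  case (Node l r)
  then show ?case
    using leaves_pos[of T] leaves_pos[of l] leaves_pos[of r] by (auto simp del: leaves_pos)
qed simp

lemma length_W_comp:
  assumes "1 \<le> i" "i \<le> length u" "v \<noteq> []"
  shows "length (W_comp u i v) = length u + length v - 1"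
  using assms by (cases v) (auto simp: W_comp_def Let_def)

text \<open>Zero-based form of the composition, with \<open>i = Suc a\<close> and
  \<open>length v = Suc b\<close>. In the last line \<open>k - b\<close> is the position in
  \<open>u\<close>, and its condition says that the interval there contains the grafting
  leaf.\<close>

lemma nth_W_comp:
  assumes "a < length u" "length v = Suc b" "k < length u + b"
  shows "W_comp u (Suc a) v ! k =
    (if k < a then u ! k
     else if k < a + b then v ! (k - a)
     else if k = a + b then last v + u ! a - 1
     else if k - b < u ! (k - b) + a then u ! (k - b) + b else u ! (k - b))"
proof -
  define tail where "tail = map (\<lambda>j. if u ! (j - 1) \<ge> j - Suc a + 1
    then u ! (j - 1) + length v - 1 else u ! (j - 1)) [Suc a + 1..<length u + 1]"
  define w where "w = [last v + u ! a - 1]"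
  have W: "W_comp u (Suc a) v = take a u @ butlast v @ w @ tail"
    by (simp add: W_comp_def Let_def tail_def w_def)
  have len: "length (take a u) = a" "length (butlast v) = b" "length w = 1"
    using assms by (simp_all add: w_def)
  consider "k < a" | "a \<le> k" "k < a + b" | "k = a + b" | "a + b < k" by linarith
  then show ?thesis
  proof cases
    case 2
    then have "k - a < b" by linarith
    with 2 show ?thesis
      using assms len by (simp add: W nth_append nth_butlast)
  next
    case 4
    then have "tail ! (k - a - b - 1) = (if k - b < u ! (k - b) + a then u ! (k - b) + b else u ! (k - b))"
    proof -
      have j: "Suc a + 1 + (k - a - b - 1) = Suc (k - b)" "k - a - b - 1 < length [Suc a + 1..<length u + 1]"
        "k - b - a < u ! (k - b) \<longleftrightarrow> k - b < u ! (k - b) + a"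
        using 4 assms by auto
      show ?thesis
        unfolding tail_def nth_map[OF j(2)] using j 4 assms(2) by (simp add: Suc_le_eq del: upt_Suc)
    qed
    moreover have "\<not> k < a" "\<not> k - a < b" "\<not> k - a - b < 1"
      using 4 by linarith+
    ultimately show ?thesis
      using 4 by (simp add: W nth_append len del: length_take length_butlast One_nat_def)
  qed (use assms len in \<open>simp_all add: W nth_append nth_butlast w_def\<close>)
qed

lemma weight_seq_graft_Suc:
  assumes "a < leaves S"
  shows "weight_seq (graft S (Suc a) T) = W_comp (weight_seq S) (Suc a) (weight_seq T)"
  using assms
proof (induction S arbitrary: a)
  case Leaf
  then show ?case
    by (auto simp: W_comp_def Let_def weight_seq_eq)
next
  case (Node l r)
  obtain b where b: "leaves T = Suc b"
    using leaves_pos[of T] by (cases "leaves T") auto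
  have neq: "weight_seq T \<noteq> []" by (simp add: weight_seq_eq)
  have len: "leaves (graft (Node l r) (Suc a) T) = leaves l + leaves r + b"
    using Node.prems b leaves_graft[of "Suc a" "Node l r" T] by simp
  show ?case
  proof (rule nth_equalityI)
    show "length (weight_seq (graft (Node l r) (Suc a) T)) =
        length (W_comp (weight_seq (Node l r)) (Suc a) (weight_seq T))"
      using Node.prems b len neq by (simp add: length_W_comp)
    fix k assume "k < length (weight_seq (graft (Node l r) (Suc a) T))"
    then have k: "k < leaves l + leaves r + b" using len by simp
    note W = nth_W_comp[where v = "weight_seq T" and b = b, unfolded length_weight_seq, OF _ b]
    show "weight_seq (graft (Node l r) (Suc a) T) ! k =
        W_comp (weight_seq (Node l r)) (Suc a) (weight_seq T) ! k"
    proof (cases "a < leaves l")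
      case True
      have lg: "leaves (graft l (Suc a) T) = leaves l + b"
        using True b leaves_graft[of "Suc a" l T] by simp
      show ?thesis
      proof (cases "k < leaves l + b")
        case kl: True
        \<comment> \<open>Up to the end of the enlarged \<open>l\<close> the formula only consults
          entries of \<open>l\<close>, so the induction hypothesis applies.\<close>
        have eq: "weight_seq (Node l r) ! j = weight_seq l ! j" if "j < leaves l" for j
          using that by (simp add: nth_weight_seq_Node)
        have "k - b < leaves l" "k < a \<Longrightarrow> k < leaves l" using True kl by linarith+
        then have "W_comp (weight_seq (Node l r)) (Suc a) (weight_seq T) ! k =
            W_comp (weight_seq l) (Suc a) (weight_seq T) ! k"
          using True kl k Node.prems by (simp add: W eq)
        then show ?thesis
          using True kl lg k Node.IH(1)[OF True] by (simp add: nth_weight_seq_Node)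
      next
        case False
        then obtain j where j: "k = leaves l + j + b" using le_iff_add[of "leaves l + b" k] by force
        then have jr: "j < leaves r" using k by simp
        \<comment> \<open>The leaf in question is leaf \<open>j + 1\<close> of \<open>r\<close>.
          Unless it is the last one of the tree, its interval stays inside \<open>r\<close> and
          misses the grafting leaf in \<open>l\<close>, so its weight does not change.\<close>
        have "weight_seq r ! j \<le> Suc j"
          using jr by (rule weight_seq_le)
        then have "\<not> leaves l + j < weight_seq r ! j + a" using True by simp
        then show ?thesis
          using True lg jr j by (simp add: nth_weight_seq_Node W)
      qed
    next
      case False
      then obtain c where c: "a = leaves l + c" using le_iff_add[of "leaves l" a] by auto
      then have cr: "c < leaves r" using Node.prems by simp
      have rg: "leaves (graft r (Suc c) T) = leaves r + b"
        using cr b leaves_graft[of "Suc c" r T] by simp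
      show ?thesis
      proof (cases "k < leaves l")
        case True
        then show ?thesis using c cr rg k by (simp add: nth_weight_seq_Node W)
      next
        case False
        then obtain j where j: "k = leaves l + j" using le_iff_add[of "leaves l" k] by auto
        then have jr: "j < leaves r + b" using k by simp
        have IH: "weight_seq (graft r (Suc c) T) ! j = W_comp (weight_seq r) (Suc c) (weight_seq T) ! j"
          using Node.IH(2)[OF cr] by simp
        \<comment> \<open>These are the leaves of \<open>r\<close> before the graft, those of
          \<open>T\<close> except its last, the last leaf of \<open>T\<close>, and the leaves of
          \<open>r\<close> after the graft, with \<open>i\<close> the position before the shift by
          \<open>b\<close>.\<close>
        consider "j < c" | "c \<le> j" "j < c + b" | "j = c + b" | i where "c + b < j" "j = i + b"
          using le_iff_add[of b j] by (metis add.commute add_leD2 linorder_not_le nat_neq_iff nat_less_le)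
        then show ?thesis
          using c cr rg jr b IH by cases (auto simp: nth_weight_seq_Node W j)
      qed
    qed
  qed
qed

lemma weight_seq_graft:
  assumes "1 \<le> i" "i \<le> leaves S"
  shows "weight_seq (graft S i T) = W_comp (weight_seq S) i (weight_seq T)"
  using assms weight_seq_graft_Suc[of "i - 1" S T] by simp

text \<open>Every entry of the composition is a monotone function of a single entry of
  \<open>u\<close> or \<open>v\<close>, and such functions preserve minima in a chain. Only the
  entry for the last leaf of \<open>v\<close> combines two; the condition on \<open>last\<close>
  makes it a function of \<open>u\<close> alone.\<close>

lemma W_comp_min:
  assumes "1 \<le> i" "i \<le> length u" "length u = length u'" "length v = length v'"
    and "v \<noteq> []" "last v = last v'"
  shows "W_comp (map2 min u u') i (map2 min v v') = map2 min (W_comp u i v) (W_comp u' i v')"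
proof (rule nth_equalityI)
  have "v' \<noteq> []" using assms by auto
  have len: "length (W_comp u i v) = length u + length v - 1"
    "length (W_comp u' i v') = length u + length v - 1"
    "length (W_comp (map2 min u u') i (map2 min v v')) = length u + length v - 1"
    using assms \<open>v' \<noteq> []\<close> by (simp_all add: length_W_comp)
  then show "length (W_comp (map2 min u u') i (map2 min v v')) =
      length (map2 min (W_comp u i v) (W_comp u' i v'))"
    by simp
  fix k assume "k < length (W_comp (map2 min u u') i (map2 min v v'))"
  then have k: "k < length u + length v - 1" using len by simp
  obtain a b where ab: "i = Suc a" "length v = Suc b"
    using assms by (cases i; cases v) auto
  have last: "last (map2 min v v') = last v"
    using assms \<open>v' \<noteq> []\<close> by (simp add: last_map last_zip)
  have u: "map2 min u u' ! j = min (u ! j) (u' ! j)" if "j < length u" for j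
    using that assms by simp
  have v: "map2 min v v' ! j = min (v ! j) (v' ! j)" if "j < length v" for j
    using that assms by simp
  have rhs: "map2 min (W_comp u i v) (W_comp u' i v') ! k = min (W_comp u i v ! k) (W_comp u' i v' ! k)"
    using k len by simp
  have au: "a < length u" and kb: "k < length u + b" using k ab assms by auto
  note W = nth_W_comp[where a = a and b = b and k = k]
  have "W_comp u i v ! k = (if k < a then u ! k
     else if k < a + b then v ! (k - a)
     else if k = a + b then last v + u ! a - 1
     else if k - b < u ! (k - b) + a then u ! (k - b) + b else u ! (k - b))"
    unfolding ab using au kb ab by (intro W)
  moreover have "W_comp u' i v' ! k = (if k < a then u' ! k
     else if k < a + b then v' ! (k - a)
     else if k = a + b then last v + u' ! a - 1
     else if k - b < u' ! (k - b) + a then u' ! (k - b) + b else u' ! (k - b))"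
    unfolding ab assms(6) using au kb ab assms by (intro W) auto
  moreover have "W_comp (map2 min u u') i (map2 min v v') ! k = (if k < a then map2 min u u' ! k
     else if k < a + b then map2 min v v' ! (k - a)
     else if k = a + b then last v + map2 min u u' ! a - 1
     else if k - b < map2 min u u' ! (k - b) + a then map2 min u u' ! (k - b) + b
     else map2 min u u' ! (k - b))"
    unfolding ab last[symmetric] using au kb ab assms by (intro W) auto
  moreover have "k < a \<Longrightarrow> k < length u" "k < a + b \<Longrightarrow> k - a < length v" "k - b < length u"
    using au kb ab by linarith+
  moreover have "last v + min (u ! a) (u' ! a) - 1 = min (last v + u ! a - 1) (last v + u' ! a - 1)"
    by (rule min_of_mono[symmetric]) (auto intro: monoI)
  \<comment> \<open>Crossing the threshold only adds \<open>b\<close>, so the case distinction is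
    monotone.\<close>
  moreover have "(if k - b < min x y + a then min x y + b else min x y) =
      min (if k - b < x + a then x + b else x) (if k - b < y + a then y + b else y)" for x y
    by (rule min_of_mono[symmetric]) (auto intro!: monoI)
  ultimately show "W_comp (map2 min u u') i (map2 min v v') ! k =
      map2 min (W_comp u i v) (W_comp u' i v') ! k"
    unfolding rhs using u[OF au] u[of k] u[of "k - b"] v[of "k - a"]
    by (simp split del: if_split) presburger
qed
section \<open>Reflection\<close>

fun mirror :: "pbt \<Rightarrow> pbt" where
  "mirror Leaf = Leaf"
| "mirror (Node l r) = Node (mirror r) (mirror l)"

lemma mirror_mirror [simp]: "mirror (mirror T) = T"
  by (induction T) auto

lemma leaves_mirror [simp]: "leaves (mirror T) = leaves T"
  by (induction T) auto

text \<open>Reflection sends \<open>A(BC)\<close> to \<open>(C'B')A'\<close> and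
  \<open>(AB)C\<close> to \<open>C'(B'A')\<close>, which exchanges the two sides of a
  rotation.\<close>

lemma left_rotation_mirror: "left_rotation S T \<Longrightarrow> left_rotation (mirror T) (mirror S)"
  by (induction rule: left_rotation.induct) (auto intro: left_rotation.intros)

lemma left_rotations_mirrorI:
  "left_rotation\<^sup>*\<^sup>* S T \<Longrightarrow> left_rotation\<^sup>*\<^sup>* (mirror T) (mirror S)"
  by (induction rule: rtranclp_induct)
    (auto intro: converse_rtranclp_into_rtranclp left_rotation_mirror)

lemma left_rotations_mirror:
  "left_rotation\<^sup>*\<^sup>* (mirror S) T \<longleftrightarrow> left_rotation\<^sup>*\<^sup>* (mirror T) S"
  using left_rotations_mirrorI[of "mirror S" T] left_rotations_mirrorI[of "mirror T" S] by auto

lemma mirror_graft: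
  assumes "1 \<le> i" "i \<le> leaves S"
  shows "mirror (graft S i T) = graft (mirror S) (leaves S + 1 - i) (mirror T)"
  using assms
proof (induction S arbitrary: i)
  case (Node l r)
  show ?case
  proof (cases "i \<le> leaves l")
    case True
    then have "\<not> leaves l + leaves r + 1 - i \<le> leaves r"
      "leaves l + leaves r + 1 - i - leaves r = leaves l + 1 - i"
      by linarith+
    with True Node show ?thesis by simp
  next
    case False
    then have "leaves l + leaves r + 1 - i \<le> leaves r"
      "leaves r + 1 - (i - leaves l) = leaves l + leaves r + 1 - i"
      using Node.prems by linarith+
    with False Node show ?thesis by simp
  qed
qed simp

section \<open>Lattices and their homomorphisms\<close>

lemma (in partial_order) greatest_LowerI2:
  assumes "x \<in> carrier L" "y \<in> carrier L" "g \<in> carrier L" "g \<sqsubseteq> x" "g \<sqsubseteq> y"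
    and "\<And>z. z \<in> carrier L \<Longrightarrow> z \<sqsubseteq> x \<Longrightarrow> z \<sqsubseteq> y \<Longrightarrow> z \<sqsubseteq> g"
  shows "greatest L g (Lower L {x, y})"
  using assms by (auto simp: greatest_def Lower_def)

lemma (in partial_order) least_UpperI2:
  assumes "x \<in> carrier L" "y \<in> carrier L" "g \<in> carrier L" "x \<sqsubseteq> g" "y \<sqsubseteq> g"
    and "\<And>z. z \<in> carrier L \<Longrightarrow> x \<sqsubseteq> z \<Longrightarrow> y \<sqsubseteq> z \<Longrightarrow> g \<sqsubseteq> z"
  shows "least L g (Upper L {x, y})"
  using assms by (auto simp: least_def Upper_def)

text \<open>\<open>meet\<close> chooses some greatest lower bound, so uniqueness is what determines
  its value. Working in a partial order allows meets to be computed before the lattice property is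
  known.\<close>

lemma (in partial_order) meet_eqI:
  assumes "x \<in> carrier L" "y \<in> carrier L" "g \<in> carrier L" "g \<sqsubseteq> x" "g \<sqsubseteq> y"
    and "\<And>z. z \<in> carrier L \<Longrightarrow> z \<sqsubseteq> x \<Longrightarrow> z \<sqsubseteq> y \<Longrightarrow> z \<sqsubseteq> g"
  shows "x \<sqinter> y = g"
  unfolding meet_def Lattice.inf_def
  using greatest_LowerI2[OF assms] greatest_unique[OF _ greatest_LowerI2[OF assms]]
  by (rule some_equality)

lemma (in partial_order) join_eqI:
  assumes "x \<in> carrier L" "y \<in> carrier L" "g \<in> carrier L" "x \<sqsubseteq> g" "y \<sqsubseteq> g"
    and "\<And>z. z \<in> carrier L \<Longrightarrow> x \<sqsubseteq> z \<Longrightarrow> y \<sqsubseteq> z \<Longrightarrow> g \<sqsubseteq> z"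
  shows "x \<squnion> y = g"
  unfolding join_def Lattice.sup_def
  using least_UpperI2[OF assms] least_unique[OF _ least_UpperI2[OF assms]]
  by (rule some_equality)

lemma (in partial_order) latticeI:
  assumes "\<And>x y. x \<in> carrier L \<Longrightarrow> y \<in> carrier L \<Longrightarrow> \<exists>g\<in>carrier L. g \<sqsubseteq> x \<and> g \<sqsubseteq> y \<and>
      (\<forall>z\<in>carrier L. z \<sqsubseteq> x \<longrightarrow> z \<sqsubseteq> y \<longrightarrow> z \<sqsubseteq> g)"
    and "\<And>x y. x \<in> carrier L \<Longrightarrow> y \<in> carrier L \<Longrightarrow> \<exists>g\<in>carrier L. x \<sqsubseteq> g \<and> y \<sqsubseteq> g \<and>
      (\<forall>z\<in>carrier L. x \<sqsubseteq> z \<longrightarrow> y \<sqsubseteq> z \<longrightarrow> g \<sqsubseteq> z)"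
  shows "lattice L"
proof unfold_locales
  fix x y assume xy: "x \<in> carrier L" "y \<in> carrier L"
  show "\<exists>s. least L s (Upper L {x, y})"
    using assms(2)[OF xy] least_UpperI2[OF xy] by blast
  show "\<exists>s. greatest L s (Lower L {x, y})"
    using assms(1)[OF xy] greatest_LowerI2[OF xy] by blast
qed

lemma partial_order_eqI:
  assumes "(.=\<^bsub>L\<^esub>) = (=)"
    and "\<And>x. x \<in> carrier L \<Longrightarrow> x \<sqsubseteq>\<^bsub>L\<^esub> x"
    and "\<And>x y. \<lbrakk>x \<sqsubseteq>\<^bsub>L\<^esub> y; y \<sqsubseteq>\<^bsub>L\<^esub> x; x \<in> carrier L; y \<in> carrier L\<rbrakk> \<Longrightarrow> x = y"
    and "\<And>x y z. \<lbrakk>x \<sqsubseteq>\<^bsub>L\<^esub> y; y \<sqsubseteq>\<^bsub>L\<^esub> z; x \<in> carrier L; y \<in> carrier L; z \<in> carrier L\<rbrakk> \<Longrightarrow> x \<sqsubseteq>\<^bsub>L\<^esub> z"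
  shows "partial_order L"
  by unfold_locales (auto simp: assms(1) intro: assms(2-4))

text \<open>The images under \<open>f\<close> of meets and joins in \<open>L\<close> have the
  universal properties in \<open>M\<close>, because \<open>f\<close> is onto and reflects the
  order.\<close>

lemma lattice_order_iso:
  assumes "lattice L" "partial_order M"
    and bij: "bij_betw f (carrier L) (carrier M)"
    and emb: "\<And>x y. x \<in> carrier L \<Longrightarrow> y \<in> carrier L \<Longrightarrow> f x \<sqsubseteq>\<^bsub>M\<^esub> f y \<longleftrightarrow> x \<sqsubseteq>\<^bsub>L\<^esub> y"
  shows "lattice M" "f \<in> lattice_hom L M"
proof -
  interpret L: lattice L by fact
  interpret M: partial_order M by fact
  have im: "carrier M = f ` carrier L" using bij by (simp add: bij_betw_def)
  show "lattice M"
  proof (rule M.latticeI)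
    fix u v assume "u \<in> carrier M" "v \<in> carrier M"
    then obtain x y where xy: "x \<in> carrier L" "y \<in> carrier L" and uv: "u = f x" "v = f y"
      by (auto simp: im)
    show "\<exists>g\<in>carrier M. g \<sqsubseteq>\<^bsub>M\<^esub> u \<and> g \<sqsubseteq>\<^bsub>M\<^esub> v \<and>
        (\<forall>z\<in>carrier M. z \<sqsubseteq>\<^bsub>M\<^esub> u \<longrightarrow> z \<sqsubseteq>\<^bsub>M\<^esub> v \<longrightarrow> z \<sqsubseteq>\<^bsub>M\<^esub> g)"
      using xy by (intro bexI[of _ "f (x \<sqinter>\<^bsub>L\<^esub> y)"])
        (auto simp: uv im emb L.meet_left L.meet_right intro: L.meet_le)
    show "\<exists>g\<in>carrier M. u \<sqsubseteq>\<^bsub>M\<^esub> g \<and> v \<sqsubseteq>\<^bsub>M\<^esub> g \<and>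
        (\<forall>z\<in>carrier M. u \<sqsubseteq>\<^bsub>M\<^esub> z \<longrightarrow> v \<sqsubseteq>\<^bsub>M\<^esub> z \<longrightarrow> g \<sqsubseteq>\<^bsub>M\<^esub> z)"
      using xy by (intro bexI[of _ "f (x \<squnion>\<^bsub>L\<^esub> y)"])
        (auto simp: uv im emb L.join_left L.join_right intro: L.join_le)
  qed
  have "f (x \<sqinter>\<^bsub>L\<^esub> y) = f x \<sqinter>\<^bsub>M\<^esub> f y" "f (x \<squnion>\<^bsub>L\<^esub> y) = f x \<squnion>\<^bsub>M\<^esub> f y"
    if "x \<in> carrier L" "y \<in> carrier L" for x y
    using that by (intro M.meet_eqI[symmetric] M.join_eqI[symmetric];
        auto simp: im emb L.meet_left L.meet_right L.join_left L.join_right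
          intro: L.meet_le L.join_le)+
  then show "f \<in> lattice_hom L M"
    by (auto simp: lattice_hom_def im)
qed

section \<open>Products of lattices and homomorphisms out of them\<close>

lemma partial_order_prod_gorder:
  assumes "partial_order L" "partial_order M"
  shows "partial_order (prod_gorder L M)"
proof -
  interpret L: partial_order L by fact
  interpret M: partial_order M by fact
  show ?thesis
    by (rule partial_order_eqI)
      (auto simp: prod_gorder_def fun_eq_iff L.eq_is_equal M.eq_is_equal
        intro: L.le_antisym M.le_antisym L.le_trans M.le_trans)
qed

lemma prod_gorder_meet_join:
  assumes "lattice L" "lattice M"
    and "x \<in> carrier L" "x' \<in> carrier L" "y \<in> carrier M" "y' \<in> carrier M"
  shows "(x, y) \<sqinter>\<^bsub>prod_gorder L M\<^esub> (x', y') = (x \<sqinter>\<^bsub>L\<^esub> x', y \<sqinter>\<^bsub>M\<^esub> y')"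
    and "(x, y) \<squnion>\<^bsub>prod_gorder L M\<^esub> (x', y') = (x \<squnion>\<^bsub>L\<^esub> x', y \<squnion>\<^bsub>M\<^esub> y')"
proof -
  interpret L: lattice L by fact
  interpret M: lattice M by fact
  interpret P: partial_order "prod_gorder L M"
    by (rule partial_order_prod_gorder) unfold_locales
  show "(x, y) \<sqinter>\<^bsub>prod_gorder L M\<^esub> (x', y') = (x \<sqinter>\<^bsub>L\<^esub> x', y \<sqinter>\<^bsub>M\<^esub> y')"
    using assms(3-) by (intro P.meet_eqI)
      (auto simp: prod_gorder_def L.meet_left L.meet_right M.meet_left M.meet_right
        intro: L.meet_le M.meet_le)
  show "(x, y) \<squnion>\<^bsub>prod_gorder L M\<^esub> (x', y') = (x \<squnion>\<^bsub>L\<^esub> x', y \<squnion>\<^bsub>M\<^esub> y')"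
    using assms(3-) by (intro P.join_eqI)
      (auto simp: prod_gorder_def L.join_left L.join_right M.join_left M.join_right
        intro: L.join_le M.join_le)
qed

lemma lattice_hom_prod_gorder_iff:
  assumes "lattice L" "lattice M"
  shows "(\<lambda>(x, y). h x y) \<in> lattice_hom (prod_gorder L M) N \<longleftrightarrow>
    (\<forall>x\<in>carrier L. \<forall>y\<in>carrier M. h x y \<in> carrier N \<and>
       (\<forall>x'\<in>carrier L. \<forall>y'\<in>carrier M.
          h (x \<sqinter>\<^bsub>L\<^esub> x') (y \<sqinter>\<^bsub>M\<^esub> y') = h x y \<sqinter>\<^bsub>N\<^esub> h x' y' \<and>
          h (x \<squnion>\<^bsub>L\<^esub> x') (y \<squnion>\<^bsub>M\<^esub> y') = h x y \<squnion>\<^bsub>N\<^esub> h x' y'))"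
proof -
  have "carrier (prod_gorder L M) = carrier L \<times> carrier M"
    by (simp add: prod_gorder_def)
  then show ?thesis
    by (fastforce simp: lattice_hom_def Pi_iff prod_gorder_meet_join[OF assms])
qed

text \<open>Every axiom for \<open>M\<close> is checked on preimages under \<open>f\<close>, which
  is onto in each arity, commutes with the compositions and, as an order isomorphism, with meets and
  joins.\<close>

lemma lattice_operad_transfer:
  assumes "lattice_operad L compL unitL"
    and iso: "lattice_operad_iso L compL unitL M compM unitM f"
    and po: "\<And>n. 1 \<le> n \<Longrightarrow> partial_order (M n)"
  shows "lattice_operad M compM unitM"
proof -
  interpret L: lattice_operad L compL unitL by fact
  have bij: "carrier (M n) = f ` carrier (L n)"
    and lat: "lattice (M n)" and hom: "f \<in> lattice_hom (L n) (M n)" if "1 \<le> n" for n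
    using iso that lattice_order_iso[OF L.component_lattice[OF that] po[OF that], of f]
    by (auto simp: lattice_operad_iso_def order_emb_def bij_betw_def)
  have obt: "\<exists>x\<in>carrier (L n). u = f x" if "u \<in> carrier (M n)" "1 \<le> n" for u n
    using that bij by auto
  have mem: "f x \<in> carrier (M n)" if "x \<in> carrier (L n)" "1 \<le> n" for x n
    using that bij by auto
  have comp: "compM (f x) i (f y) = f (compL x i y)"
    if "x \<in> carrier (L m)" "y \<in> carrier (L n)" "1 \<le> i" "i \<le> m" "1 \<le> n" for x y i m n
    using iso that by (auto simp: lattice_operad_iso_def)
  have unit: "unitM = f unitL" using iso by (simp add: lattice_operad_iso_def)
  show ?thesis
  proof (intro lattice_operad.intro ns_operad.intro lattice_operad_axioms.intro)
    show "unitM \<in> carrier (M 1)"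
      using mem[OF L.unit_closed] unit by simp
  next
    fix u v m n i assume uv: "u \<in> carrier (M m)" "v \<in> carrier (M n)"
      and i: "1 \<le> i" "i \<le> m" "1 \<le> (n::nat)"
    obtain x y where "x \<in> carrier (L m)" "u = f x" "y \<in> carrier (L n)" "v = f y"
      using obt uv i by (meson order_trans)
    then show "compM u i v \<in> carrier (M (m + n - 1))"
      using i mem[OF L.comp_closed] by (simp add: comp)
  next
    fix v n assume v: "v \<in> carrier (M n)" and n: "1 \<le> (n::nat)"
    then obtain y where "y \<in> carrier (L n)" "v = f y" using obt by blast
    then show "compM unitM 1 v = v"
      using n comp[OF L.unit_closed, of y n 1] by (simp add: unit L.left_unit del: One_nat_def)
  next
    fix u m i assume u: "u \<in> carrier (M m)" and i: "1 \<le> i" "i \<le> (m::nat)"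
    then obtain x where "x \<in> carrier (L m)" "u = f x" using obt by (meson order_trans)
    then show "compM u i unitM = u"
      using i comp[OF _ L.unit_closed, of x m i] by (simp add: unit L.right_unit)
  next
    fix u l v m w n i j
    assume uvw: "u \<in> carrier (M l)" "v \<in> carrier (M m)" "w \<in> carrier (M n)"
      and ij: "1 \<le> i" "i \<le> l" "1 \<le> j" "j \<le> m" "1 \<le> (n::nat)"
    obtain x y z where xyz: "x \<in> carrier (L l)" "y \<in> carrier (L m)" "z \<in> carrier (L n)"
      and "u = f x" "v = f y" "w = f z"
      using obt uvw ij by (meson order_trans)
    moreover have "compL x i y \<in> carrier (L (l + m - 1))" "compL y j z \<in> carrier (L (m + n - 1))"
      using xyz ij by (simp_all add: L.comp_closed del: One_nat_def)
    ultimately show "compM (compM u i v) (i + j - 1) w = compM u i (compM v j w)"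
      using ij comp[of "compL x i y" "l + m - 1" z n "i + j - 1"]
        comp[of x l "compL y j z" "m + n - 1" i] comp[of x l y m i] comp[of y m z n j]
        L.sequential_assoc[OF xyz]
      by simp
  next
    fix u l v m w n i k
    assume uvw: "u \<in> carrier (M l)" "v \<in> carrier (M m)" "w \<in> carrier (M n)"
      and ik: "1 \<le> i" "i < k" "k \<le> l" "1 \<le> m" "1 \<le> (n::nat)"
    have l: "1 \<le> l" using ik by simp
    obtain x y z where xyz: "x \<in> carrier (L l)" "y \<in> carrier (L m)" "z \<in> carrier (L n)"
      and "u = f x" "v = f y" "w = f z"
      using obt uvw ik l by meson
    moreover have "compL x i y \<in> carrier (L (l + m - 1))" "compL x k z \<in> carrier (L (l + n - 1))"
      using xyz ik by (simp_all add: L.comp_closed del: One_nat_def)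
    ultimately show "compM (compM u i v) (k + m - 1) w = compM (compM u k w) i v"
      using ik comp[of "compL x i y" "l + m - 1" z n "k + m - 1"]
        comp[of "compL x k z" "l + n - 1" y m i] comp[of x l y m i] comp[of x l z n k]
        L.parallel_assoc[OF xyz]
      by simp
  next
    fix n :: nat assume "1 \<le> n"
    then show "lattice (M n)" by (rule lat)
  next
    fix i m n :: nat assume i: "1 \<le> i" "i \<le> m" "1 \<le> n"
    then have m: "1 \<le> m" and mn: "1 \<le> m + n - 1" by simp_all
    have f_mj: "f (x \<sqinter>\<^bsub>L n\<^esub> y) = f x \<sqinter>\<^bsub>M n\<^esub> f y" "f (x \<squnion>\<^bsub>L n\<^esub> y) = f x \<squnion>\<^bsub>M n\<^esub> f y"
      if "x \<in> carrier (L n)" "y \<in> carrier (L n)" "1 \<le> n" for x y n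
      using hom that by (auto simp: lattice_hom_def)
    interpret Lm: lattice "L m" using m by (rule L.component_lattice)
    interpret Ln: lattice "L n" using i(3) by (rule L.component_lattice)
    \<comment> \<open>Stated elementwise, the homomorphism property can be rewritten along
      \<open>f\<close>.\<close>
    have h: "\<forall>x\<in>carrier (L m). \<forall>y\<in>carrier (L n). compL x i y \<in> carrier (L (m + n - 1)) \<and>
       (\<forall>x'\<in>carrier (L m). \<forall>y'\<in>carrier (L n).
          compL (x \<sqinter>\<^bsub>L m\<^esub> x') i (y \<sqinter>\<^bsub>L n\<^esub> y') = compL x i y \<sqinter>\<^bsub>L (m + n - 1)\<^esub> compL x' i y' \<and>
          compL (x \<squnion>\<^bsub>L m\<^esub> x') i (y \<squnion>\<^bsub>L n\<^esub> y') = compL x i y \<squnion>\<^bsub>L (m + n - 1)\<^esub> compL x' i y')"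
      using L.comp_hom[OF i]
      by (subst (asm) lattice_hom_prod_gorder_iff) (use m i in \<open>auto intro: L.component_lattice\<close>)
    show "(\<lambda>(x, y). compM x i y) \<in> lattice_hom (prod_gorder (M m) (M n)) (M (m + n - 1))"
      unfolding lattice_hom_prod_gorder_iff[OF lat[OF m] lat[OF i(3)]] bij[OF m] bij[OF i(3)]
      using h i m mn
      by (simp add: f_mj[symmetric] comp[of _ m _ n] mem del: One_nat_def)
  qed
qed

section \<open>The two lattice operads\<close>

lemma Tamari_simps [simp]:
  "carrier (Tamari n) = PBT n" "(.=\<^bsub>Tamari n\<^esub>) = (=)" "(\<sqsubseteq>\<^bsub>Tamari n\<^esub>) = left_rotation\<^sup>*\<^sup>*"
  by (simp_all add: Tamari_def)

lemma W_lattice_simps [simp]: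
  "carrier (W_lattice n) = W n" "(.=\<^bsub>W_lattice n\<^esub>) = (=)" "(\<sqsubseteq>\<^bsub>W_lattice n\<^esub>) = list_all2 (\<le>)"
  by (simp_all add: W_lattice_def)

section \<open>Meets and joins in the Tamari order\<close>

lemma partial_order_W_lattice: "partial_order (W_lattice n)"
proof (rule partial_order_eqI; unfold W_lattice_simps)
  fix x y z :: "nat list"
  show "list_all2 (\<le>) x x" by (rule list_all2_refl) simp
  show "x = y" if "list_all2 (\<le>) x y" "list_all2 (\<le>) y x"
    using that list_all2_antisym[of "(\<le>)" "(\<le>)" x y] by auto
  show "list_all2 (\<le>) x z" if "list_all2 (\<le>) x y" "list_all2 (\<le>) y z"
    using order_trans that by (rule list_all2_trans)
qed (rule refl)

lemma partial_order_Tamari: "partial_order (Tamari n)"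
proof (rule partial_order_eqI)
  fix S T assume "S \<sqsubseteq>\<^bsub>Tamari n\<^esub> T" "T \<sqsubseteq>\<^bsub>Tamari n\<^esub> S"
  then show "S = T"
    using list_all2_antisym[of "(\<le>)" "(\<le>)" "left_sizes S" "left_sizes T"]
    by (auto simp: left_rotations_iff_left_sizes left_sizes_inject)
qed auto

lemma list_all2_map2_min:
  fixes x y z :: "nat list"
  assumes "length x = length y"
  shows "list_all2 (\<le>) z (map2 min x y) \<longleftrightarrow> list_all2 (\<le>) z x \<and> list_all2 (\<le>) z y"
  using assms by (auto simp: list_all2_conv_all_nth)

lemma Tamari_glb:
  assumes "S \<in> PBT n" "T \<in> PBT n" "weight_seq M = map2 min (weight_seq S) (weight_seq T)"
  shows "M \<in> PBT n"
    and "X \<in> PBT n \<Longrightarrow> left_rotation\<^sup>*\<^sup>* X M \<longleftrightarrow> left_rotation\<^sup>*\<^sup>* X S \<and> left_rotation\<^sup>*\<^sup>* X T"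
proof -
  show M: "M \<in> PBT n"
    using assms(1,2) arg_cong[OF assms(3), of length] by (simp add: PBT_def)
  show "left_rotation\<^sup>*\<^sup>* X M \<longleftrightarrow> left_rotation\<^sup>*\<^sup>* X S \<and> left_rotation\<^sup>*\<^sup>* X T" if "X \<in> PBT n"
    using M that assms by (simp add: PBT_def left_rotations_iff_weight_seq list_all2_map2_min)
qed

lemma weight_seq_meet:
  assumes "S \<in> PBT n" "T \<in> PBT n"
  shows "weight_seq (S \<sqinter>\<^bsub>Tamari n\<^esub> T) = map2 min (weight_seq S) (weight_seq T)"
proof -
  interpret partial_order "Tamari n" by (rule partial_order_Tamari)
  obtain M where M: "weight_seq M = map2 min (weight_seq S) (weight_seq T)"
    using weight_seq_min[of S T] assms by (auto simp: PBT_def)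
  note glb = Tamari_glb[OF assms M]
  \<comment> \<open>Taking \<open>X = M\<close> in the characterization shows that \<open>M\<close>
    is itself a lower bound.\<close>
  have "S \<sqinter>\<^bsub>Tamari n\<^esub> T = M"
    using assms glb(1) glb(2)[of M] by (intro meet_eqI) (auto simp: glb(2))
  then show ?thesis using M by simp
qed

lemma
  assumes "S \<in> PBT n" "T \<in> PBT n"
  shows Tamari_meet_closed: "S \<sqinter>\<^bsub>Tamari n\<^esub> T \<in> PBT n"
    and Tamari_le_meet_iff: "X \<in> PBT n \<Longrightarrow>
      left_rotation\<^sup>*\<^sup>* X (S \<sqinter>\<^bsub>Tamari n\<^esub> T) \<longleftrightarrow> left_rotation\<^sup>*\<^sup>* X S \<and> left_rotation\<^sup>*\<^sup>* X T"
  using Tamari_glb[OF assms weight_seq_meet[OF assms]] by simp_all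

lemma mirror_in_PBT [simp]: "mirror T \<in> PBT n \<longleftrightarrow> T \<in> PBT n"
  by (simp add: PBT_def)

text \<open>Reflection reverses the order, so the universal property of the meet of the mirror
  images becomes that of a join of \<open>S\<close> and \<open>T\<close>.\<close>

lemma Tamari_lub:
  assumes "S \<in> PBT n" "T \<in> PBT n" "X \<in> PBT n"
  shows "left_rotation\<^sup>*\<^sup>* (mirror (mirror S \<sqinter>\<^bsub>Tamari n\<^esub> mirror T)) X \<longleftrightarrow>
    left_rotation\<^sup>*\<^sup>* S X \<and> left_rotation\<^sup>*\<^sup>* T X"
  using assms left_rotations_mirror[of X "mirror S"] left_rotations_mirror[of X "mirror T"]
  by (simp add: left_rotations_mirror[of "_ \<sqinter>\<^bsub>_\<^esub> _"] Tamari_le_meet_iff)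

lemma lattice_Tamari: "lattice (Tamari n)"
proof -
  interpret partial_order "Tamari n" by (rule partial_order_Tamari)
  show ?thesis
  proof (rule latticeI; unfold Tamari_simps)
    fix S T assume ST: "S \<in> PBT n" "T \<in> PBT n"
    let ?M = "S \<sqinter>\<^bsub>Tamari n\<^esub> T" and ?J = "mirror (mirror S \<sqinter>\<^bsub>Tamari n\<^esub> mirror T)"
    have cl: "?M \<in> PBT n" "?J \<in> PBT n" using ST by (simp_all add: Tamari_meet_closed)
    show "\<exists>g\<in>PBT n. left_rotation\<^sup>*\<^sup>* g S \<and> left_rotation\<^sup>*\<^sup>* g T \<and>
        (\<forall>z\<in>PBT n. left_rotation\<^sup>*\<^sup>* z S \<longrightarrow> left_rotation\<^sup>*\<^sup>* z T \<longrightarrow> left_rotation\<^sup>*\<^sup>* z g)"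
      using ST cl Tamari_le_meet_iff[OF ST cl(1)]
      by (intro bexI[of _ ?M]) (auto simp: Tamari_le_meet_iff)
    show "\<exists>g\<in>PBT n. left_rotation\<^sup>*\<^sup>* S g \<and> left_rotation\<^sup>*\<^sup>* T g \<and>
        (\<forall>z\<in>PBT n. left_rotation\<^sup>*\<^sup>* S z \<longrightarrow> left_rotation\<^sup>*\<^sup>* T z \<longrightarrow> left_rotation\<^sup>*\<^sup>* g z)"
      using ST cl Tamari_lub[OF ST, of ?J]
      by (intro bexI[of _ ?J]) (auto simp: Tamari_lub)
  qed
qed

lemma Tamari_join_mirror:
  assumes "S \<in> PBT n" "T \<in> PBT n"
  shows "S \<squnion>\<^bsub>Tamari n\<^esub> T = mirror (mirror S \<sqinter>\<^bsub>Tamari n\<^esub> mirror T)"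
proof -
  interpret partial_order "Tamari n" by (rule partial_order_Tamari)
  let ?J = "mirror (mirror S \<sqinter>\<^bsub>Tamari n\<^esub> mirror T)"
  have "?J \<in> PBT n" using assms by (simp add: Tamari_meet_closed)
  then show ?thesis
    using assms Tamari_lub[OF assms, of ?J] by (intro join_eqI) (auto simp: Tamari_lub)
qed

section \<open>Compatibility of grafting with meets and joins\<close>

lemma graft_in_PBT:
  "\<lbrakk>S \<in> PBT m; T \<in> PBT n; 1 \<le> i; i \<le> m\<rbrakk> \<Longrightarrow> graft S i T \<in> PBT (m + n - 1)"
  by (auto simp: PBT_def leaves_graft)

text \<open>Both sides are compared through the injective map \<open>weight_seq\<close>, under which
  meets are entrywise minima and grafting is \<open>W_comp\<close>.\<close>

lemma graft_meet:
  assumes "S \<in> PBT m" "S' \<in> PBT m" "T \<in> PBT n" "T' \<in> PBT n" "1 \<le> i" "i \<le> m"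
  shows "graft (S \<sqinter>\<^bsub>Tamari m\<^esub> S') i (T \<sqinter>\<^bsub>Tamari n\<^esub> T') =
    graft S i T \<sqinter>\<^bsub>Tamari (m + n - 1)\<^esub> graft S' i T'"
proof -
  have "S \<sqinter>\<^bsub>Tamari m\<^esub> S' \<in> PBT m"
    using assms by (simp add: Tamari_meet_closed)
  then have "weight_seq (graft (S \<sqinter>\<^bsub>Tamari m\<^esub> S') i (T \<sqinter>\<^bsub>Tamari n\<^esub> T')) =
      W_comp (map2 min (weight_seq S) (weight_seq S')) i (map2 min (weight_seq T) (weight_seq T'))"
    using assms by (simp add: PBT_def weight_seq_graft weight_seq_meet)
  also have "\<dots> = map2 min (weight_seq (graft S i T)) (weight_seq (graft S' i T'))"
    \<comment> \<open>The last entries agree as required: both are \<open>n\<close>, the number of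
      leaves of \<open>T\<close> and of \<open>T'\<close>.\<close>
    using assms by (subst W_comp_min) (auto simp: PBT_def weight_seq_graft)
  also have "\<dots> = weight_seq (graft S i T \<sqinter>\<^bsub>Tamari (m + n - 1)\<^esub> graft S' i T')"
    using assms by (simp add: weight_seq_meet graft_in_PBT del: One_nat_def)
  finally show ?thesis by (simp add: weight_seq_inject)
qed

text \<open>This is \<open>graft_meet\<close> conjugated by reflection, which moves the grafting
  leaf from \<open>i\<close> to \<open>m + 1 - i\<close>.\<close>

lemma graft_join:
  assumes "S \<in> PBT m" "S' \<in> PBT m" "T \<in> PBT n" "T' \<in> PBT n" "1 \<le> i" "i \<le> m"
  shows "graft (S \<squnion>\<^bsub>Tamari m\<^esub> S') i (T \<squnion>\<^bsub>Tamari n\<^esub> T') =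
    graft S i T \<squnion>\<^bsub>Tamari (m + n - 1)\<^esub> graft S' i T'"
proof -
  let ?A = "mirror S \<sqinter>\<^bsub>Tamari m\<^esub> mirror S'" and ?B = "mirror T \<sqinter>\<^bsub>Tamari n\<^esub> mirror T'"
  have "?A \<in> PBT m" using assms by (simp add: Tamari_meet_closed)
  then have "mirror (graft (mirror ?A) i (mirror ?B)) = graft ?A (m + 1 - i) ?B"
    using assms by (subst mirror_graft) (auto simp: PBT_def)
  also have "\<dots> = graft (mirror S) (m + 1 - i) (mirror T) \<sqinter>\<^bsub>Tamari (m + n - 1)\<^esub>
      graft (mirror S') (m + 1 - i) (mirror T')"
    using assms by (intro graft_meet) auto
  also have "\<dots> = mirror (graft S i T) \<sqinter>\<^bsub>Tamari (m + n - 1)\<^esub> mirror (graft S' i T')"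
    using assms by (auto simp: mirror_graft PBT_def)
  finally have "graft (mirror ?A) i (mirror ?B) =
      mirror (mirror (graft S i T) \<sqinter>\<^bsub>Tamari (m + n - 1)\<^esub> mirror (graft S' i T'))"
    by (metis mirror_mirror)
  then show ?thesis
    using assms
    by (simp add: Tamari_join_mirror[OF graft_in_PBT graft_in_PBT] Tamari_join_mirror
        del: One_nat_def)
qed

section \<open>Operad axioms for grafting of trees\<close>

lemma graft_Leaf_right [simp]: "graft S i Leaf = S"
  by (induction S arbitrary: i) auto

lemma graft_sequential:
  assumes "1 \<le> i" "i \<le> leaves S" "1 \<le> j" "j \<le> leaves T"
  shows "graft (graft S i T) (i + j - 1) U = graft S i (graft T j U)"
  using assms
proof (induction S arbitrary: i)
  case (Node l r)
  show ?case
  proof (cases "i \<le> leaves l")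
    case True
    then have "i + j - 1 \<le> leaves (graft l i T)"
      using Node.prems by (simp add: leaves_graft)
    then show ?thesis using True Node by simp
  next
    case False
    moreover have "\<not> i + j - 1 \<le> leaves l" "i + j - 1 - leaves l = i - leaves l + j - 1"
      using False Node.prems by linarith+
    ultimately show ?thesis using Node.IH(2)[of "i - leaves l"] Node.prems by simp
  qed
qed simp

text \<open>Grafting \<open>T\<close> at the earlier leaf \<open>i\<close> moves leaf
  \<open>k\<close> to \<open>k + leaves T - 1\<close>. Once the root separates the two leaves, the
  grafts happen in different subtrees; otherwise induction applies to the common subtree.\<close>

lemma graft_parallel:
  assumes "1 \<le> i" "i < k" "k \<le> leaves S"
  shows "graft (graft S i T) (k + leaves T - 1) U = graft (graft S k U) i T"
  using assms
proof (induction S arbitrary: i k)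
  case (Node l r)
  have T: "0 < leaves T" by simp
  consider "k \<le> leaves l" | "i \<le> leaves l" "leaves l < k" | "leaves l < i" by linarith
  then show ?case
  proof cases
    case 1
    moreover have "k + leaves T - 1 \<le> leaves (graft l i T)"
      using 1 Node.prems by (simp add: leaves_graft)
    moreover have "i \<le> leaves (graft l k U)"
      using 1 Node.prems leaves_pos[of U] by (simp add: leaves_graft del: leaves_pos)
    ultimately show ?thesis using Node by simp
  next
    case 2
    moreover have "leaves (graft l i T) = leaves l + leaves T - 1"
      using 2 Node.prems by (simp add: leaves_graft)
    moreover have "\<not> k + leaves T - 1 \<le> leaves l + leaves T - 1"
      "k + leaves T - 1 - (leaves l + leaves T - 1) = k - leaves l"
      using 2 T by linarith+
    ultimately show ?thesis using Node.prems by simp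
  next
    case 3
    moreover have "\<not> k + leaves T - 1 \<le> leaves l"
      "k + leaves T - 1 - leaves l = k - leaves l + leaves T - 1"
      using 3 Node.prems T by linarith+
    ultimately show ?thesis
      using Node.IH(2)[of "i - leaves l" "k - leaves l"] Node.prems by simp
  qed
qed simp

lemma lattice_operad_Tamari: "lattice_operad Tamari graft Leaf"
proof (intro lattice_operad.intro ns_operad.intro lattice_operad_axioms.intro)
  fix i m n :: nat assume "1 \<le> i" "i \<le> m" "1 \<le> n"
  then show "(\<lambda>(x, y). graft x i y) \<in>
      lattice_hom (prod_gorder (Tamari m) (Tamari n)) (Tamari (m + n - 1))"
    unfolding lattice_hom_prod_gorder_iff[OF lattice_Tamari lattice_Tamari]
    by (simp add: graft_in_PBT graft_meet graft_join del: One_nat_def)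
qed (auto simp: PBT_def leaves_graft graft_sequential graft_parallel lattice_Tamari
    simp del: One_nat_def)

lemma lattice_operad_iso_weight_seq:
  "lattice_operad_iso Tamari graft Leaf W_lattice W_comp [1] weight_seq"
proof -
  have "bij_betw weight_seq (PBT n) (W n)" for n
    by (auto simp: bij_betw_def W_def inj_on_def weight_seq_inject)
  moreover have "order_emb (Tamari n) (W_lattice n) weight_seq" for n
    using partial_order_Tamari partial_order_W_lattice
    by (auto simp: order_emb_def partial_order_def PBT_def left_rotations_iff_weight_seq)
  moreover have "weight_seq Leaf = [1]"
    by (simp add: weight_seq_eq)
  ultimately show ?thesis
    by (auto simp: lattice_operad_iso_def PBT_def weight_seq_graft)
qed

theorem theorem4p2:
  shows
    "(\<forall>n\<ge>1. lattice (W_lattice n)) \<and>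
     (\<forall>m n i. 1 \<le> i \<longrightarrow> i \<le> m \<longrightarrow> 1 \<le> n \<longrightarrow>
        (\<lambda>(u, v). W_comp u i v)
          \<in> lattice_hom (prod_gorder (W_lattice m) (W_lattice n)) (W_lattice (m + n - 1))) \<and>
     lattice_operad W_lattice W_comp [1] \<and>
     lattice_operad Tamari graft Leaf \<and>
     lattice_operad_iso Tamari graft Leaf W_lattice W_comp [1] weight_seq"
proof -
  \<comment> \<open>The operad axioms for \<open>W_comp\<close> are not computed from its formula
    but inherited from trees.\<close>
  have "lattice_operad W_lattice W_comp [1]"
    using lattice_operad_Tamari lattice_operad_iso_weight_seq partial_order_W_lattice
    by (rule lattice_operad_transfer)
  then show ?thesis
    using lattice_operad_Tamari lattice_operad_iso_weight_seq
    by (intro conjI allI impI) (auto simp del: One_nat_def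
        intro: lattice_operad.component_lattice lattice_operad.comp_hom)
qed

end
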